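(* Let $M\xrightarrow{P}A$ be a relative averaging algebra and $(N\xrightarrow{Q}B,l,r)$ a bimodule over it. Then the vector space $B$ carries a representation of the induced diassociative algebra $M_P$ with action maps, for $u\in M$, $b\in B$, $$u\dashv b=P(u)\cdot_Bb-Q(l(u,b)),\quad u\vdash b=P(u)\cdot_Bb,\quad b\dashv u=b\cdot_BP(u),\quad b\vdash u=b\cdot_BP(u)-Q(r(b,u)).$$
   Context: Vector spaces are over a field of characteristic $0$; associative algebras are not assumed unital. A relative averaging algebra $M\xrightarrow{P}A$ consists of an associative algebra $A$, an $A$-bimodule $M$ (both actions written $\cdot_M$) and a linear map $P:M\to A$ with $P(u)\cdot P(v)=P(P(u)\cdot_Mv)=P(u\cdot_MP(v))$ for all $u,v\in M$. A bimodule over $M\xrightarrow{P}A$ is a tuple $(N\xrightarrow{Q}B,l,r)$ where $N,B$ are $A$-bimodules, $Q:N\to B$ is a linear map, and $l:M\times B\to N$, $r:B\times M\to N$ are bilinear maps such that for $a\in A,b\in B,u\in M,n\in N$: $l(a\cdot_Mu,b)=a\cdot_Nl(u,b)$, $l(u\cdot_Ma,b)=l(u,a\cdot_Bb)$, $l(u,b\cdot_Ba)=l(u,b)\cdot_Na$; $r(a\cdot_Bb,u)=a\cdot_Nr(b,u)$, $r(b\cdot_Ba,u)=r(b,a\cdot_Mu)$, $r(b,u\cdot_Ma)=r(b,u)\cdot_Na$; $P(u)\cdot_BQ(n)=Q(P(u)\cdot_Nn)=Q(l(u,Q(n)))$; $Q(n)\cdot_BP(u)=Q(r(Q(n),u))=Q(n\cdot_NP(u))$.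 A diassociative algebra is a vector space $D$ with bilinear operations $\dashv,\vdash$ satisfying the five identities $(a\dashv b)\dashv c=a\dashv(b\dashv c)=a\dashv(b\vdash c)$, $(a\vdash b)\dashv c=a\vdash(b\dashv c)$, $(a\dashv b)\vdash c=(a\vdash b)\vdash c=a\vdash(b\vdash c)$. A representation of $D$ is a vector space $V$ with four bilinear maps $\dashv,\vdash:D\times V\to V$ and $\dashv,\vdash:V\times D\to V$ satisfying the fifteen identities obtained from the five above by taking exactly one of $a,b,c$ in $V$ and the other two in $D$. $M_P$ is the diassociative algebra $M$ with $u\dashv_Pv=u\cdot_MP(v)$, $u\vdash_Pv=P(u)\cdot_Mv$. *)

theory Defs
  imports Complex_Main
begin

text \<open>
  A vector space is a scalar multiplication on a whole type of class \<open>ab_group_add\<close>, as in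
  the library locale \<open>vector_space\<close>. The library predicate \<open>Vector_Spaces.linear\<close>, and hence
  \<open>bilinear_map\<close>, includes that all spaces involved are vector spaces over the same field.
\<close>

definition bilinear_map ::
    "('k::field \<Rightarrow> 'u \<Rightarrow> 'u::ab_group_add) \<Rightarrow> ('k \<Rightarrow> 'v \<Rightarrow> 'v::ab_group_add) \<Rightarrow>
     ('k \<Rightarrow> 'w \<Rightarrow> 'w::ab_group_add) \<Rightarrow> ('u \<Rightarrow> 'v \<Rightarrow> 'w) \<Rightarrow> bool" where
  "bilinear_map sU sV sW f \<longleftrightarrow>
     (\<forall>u. Vector_Spaces.linear sV sW (\<lambda>v. f u v)) \<and>
     (\<forall>v. Vector_Spaces.linear sU sW (\<lambda>u. f u v))"

locale assoc_algebra =
  fixes sA :: "'k::field \<Rightarrow> 'a::ab_group_add \<Rightarrow> 'a"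
    and mul :: "'a \<Rightarrow> 'a \<Rightarrow> 'a" (infixl \<open>\<cdot>\<close> 70)
  assumes mul_bilinear: "bilinear_map sA sA sA (\<cdot>)"
    and mul_assoc: "(a \<cdot> b) \<cdot> c = a \<cdot> (b \<cdot> c)"

locale alg_bimodule = assoc_algebra sA mul
  for sA :: "'k::field \<Rightarrow> 'a::ab_group_add \<Rightarrow> 'a"
    and mul :: "'a \<Rightarrow> 'a \<Rightarrow> 'a" (infixl \<open>\<cdot>\<close> 70) +
  fixes sM :: "'k \<Rightarrow> 'm::ab_group_add \<Rightarrow> 'm"
    and lact :: "'a \<Rightarrow> 'm \<Rightarrow> 'm" (infixr \<open>\<rhd>\<close> 70)
    and ract :: "'m \<Rightarrow> 'a \<Rightarrow> 'm" (infixl \<open>\<lhd>\<close> 70)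
  assumes lact_bilinear: "bilinear_map sA sM sM (\<rhd>)"
    and ract_bilinear: "bilinear_map sM sA sM (\<lhd>)"
    and lact_mul: "(a \<cdot> b) \<rhd> u = a \<rhd> (b \<rhd> u)"
    and lact_ract: "(a \<rhd> u) \<lhd> b = a \<rhd> (u \<lhd> b)"
    and ract_mul: "u \<lhd> (a \<cdot> b) = (u \<lhd> a) \<lhd> b"

locale relative_averaging_algebra =
  assoc_algebra sA mul + M: alg_bimodule sA mul sM lM rM
  for sA :: "'k::field \<Rightarrow> 'a::ab_group_add \<Rightarrow> 'a"
    and mul :: "'a \<Rightarrow> 'a \<Rightarrow> 'a" (infixl \<open>\<cdot>\<close> 70)
    and sM :: "'k \<Rightarrow> 'm::ab_group_add \<Rightarrow> 'm"
    and lM :: "'a \<Rightarrow> 'm \<Rightarrow> 'm" (infixr \<open>\<rhd>\<^sub>M\<close> 70)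
    and rM :: "'m \<Rightarrow> 'a \<Rightarrow> 'm" (infixl \<open>\<lhd>\<^sub>M\<close> 70) +
  fixes P :: "'m \<Rightarrow> 'a"
  assumes P_linear: "Vector_Spaces.linear sM sA P"
    and P_left: "P u \<cdot> P v = P (P u \<rhd>\<^sub>M v)"
    and P_right: "P u \<cdot> P v = P (u \<lhd>\<^sub>M P v)"

locale relative_averaging_bimodule =
  relative_averaging_algebra sA mul sM lM rM P +
  N: alg_bimodule sA mul sN lN rN + B: alg_bimodule sA mul sB lB rB
  for sA :: "'k::field \<Rightarrow> 'a::ab_group_add \<Rightarrow> 'a"
    and mul :: "'a \<Rightarrow> 'a \<Rightarrow> 'a" (infixl \<open>\<cdot>\<close> 70)
    and sM :: "'k \<Rightarrow> 'm::ab_group_add \<Rightarrow> 'm"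
    and lM :: "'a \<Rightarrow> 'm \<Rightarrow> 'm" (infixr \<open>\<rhd>\<^sub>M\<close> 70)
    and rM :: "'m \<Rightarrow> 'a \<Rightarrow> 'm" (infixl \<open>\<lhd>\<^sub>M\<close> 70)
    and P :: "'m \<Rightarrow> 'a"
    and sN :: "'k \<Rightarrow> 'n::ab_group_add \<Rightarrow> 'n"
    and lN :: "'a \<Rightarrow> 'n \<Rightarrow> 'n" (infixr \<open>\<rhd>\<^sub>N\<close> 70)
    and rN :: "'n \<Rightarrow> 'a \<Rightarrow> 'n" (infixl \<open>\<lhd>\<^sub>N\<close> 70)
    and sB :: "'k \<Rightarrow> 'b::ab_group_add \<Rightarrow> 'b"
    and lB :: "'a \<Rightarrow> 'b \<Rightarrow> 'b" (infixr \<open>\<rhd>\<^sub>B\<close> 70)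
    and rB :: "'b \<Rightarrow> 'a \<Rightarrow> 'b" (infixl \<open>\<lhd>\<^sub>B\<close> 70) +
  fixes Q :: "'n \<Rightarrow> 'b"
    and l :: "'m \<Rightarrow> 'b \<Rightarrow> 'n"
    and r :: "'b \<Rightarrow> 'm \<Rightarrow> 'n"
  assumes Q_linear: "Vector_Spaces.linear sN sB Q"
    and l_bilinear: "bilinear_map sM sB sN l"
    and r_bilinear: "bilinear_map sB sM sN r"
    and l_left: "l (a \<rhd>\<^sub>M u) b = a \<rhd>\<^sub>N l u b"
    and l_mid: "l (u \<lhd>\<^sub>M a) b = l u (a \<rhd>\<^sub>B b)"
    and l_right: "l u (b \<lhd>\<^sub>B a) = l u b \<lhd>\<^sub>N a"
    and r_left: "r (a \<rhd>\<^sub>B b) u = a \<rhd>\<^sub>N r b u"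
    and r_mid: "r (b \<lhd>\<^sub>B a) u = r b (a \<rhd>\<^sub>M u)"
    and r_right: "r b (u \<lhd>\<^sub>M a) = r b u \<lhd>\<^sub>N a"
    and PQ_left: "P u \<rhd>\<^sub>B Q n = Q (P u \<rhd>\<^sub>N n)"
    and PQ_l: "P u \<rhd>\<^sub>B Q n = Q (l u (Q n))"
    and QP_r: "Q n \<lhd>\<^sub>B P u = Q (r (Q n) u)"
    and QP_right: "Q n \<lhd>\<^sub>B P u = Q (n \<lhd>\<^sub>N P u)"

locale diassociative_algebra =
  fixes sD :: "'k::field \<Rightarrow> 'd::ab_group_add \<Rightarrow> 'd"
    and dl :: "'d \<Rightarrow> 'd \<Rightarrow> 'd" (infixl \<open>\<stileturn>\<close> 70)
    and dr :: "'d \<Rightarrow> 'd \<Rightarrow> 'd" (infixl \<open>\<turnstile>\<close> 70)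
  assumes dl_bilinear: "bilinear_map sD sD sD (\<stileturn>)"
    and dr_bilinear: "bilinear_map sD sD sD (\<turnstile>)"
    and di1: "(a \<stileturn> b) \<stileturn> c = a \<stileturn> (b \<stileturn> c)"
    and di2: "(a \<stileturn> b) \<stileturn> c = a \<stileturn> (b \<turnstile> c)"
    and di3: "(a \<turnstile> b) \<stileturn> c = a \<turnstile> (b \<stileturn> c)"
    and di4: "(a \<stileturn> b) \<turnstile> c = a \<turnstile> (b \<turnstile> c)"
    and di5: "(a \<turnstile> b) \<turnstile> c = a \<turnstile> (b \<turnstile> c)"

text \<open>
  The subscript \<open>L\<close> marks the actions \<open>D \<times> V \<rightarrow> V\<close> and \<open>R\<close> the actions
  \<open>V \<times> D \<rightarrow> V\<close>. The suffixes 1, 2, 3 of the identities give the position of the element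
  of \<open>V\<close> in the corresponding identity of a diassociative algebra.
\<close>

locale diassociative_representation = diassociative_algebra sD dl dr
  for sD :: "'k::field \<Rightarrow> 'd::ab_group_add \<Rightarrow> 'd"
    and dl :: "'d \<Rightarrow> 'd \<Rightarrow> 'd" (infixl \<open>\<stileturn>\<close> 70)
    and dr :: "'d \<Rightarrow> 'd \<Rightarrow> 'd" (infixl \<open>\<turnstile>\<close> 70) +
  fixes sV :: "'k \<Rightarrow> 'v::ab_group_add \<Rightarrow> 'v"
    and dlL :: "'d \<Rightarrow> 'v \<Rightarrow> 'v" (infixl \<open>\<stileturn>\<^sub>L\<close> 70)
    and drL :: "'d \<Rightarrow> 'v \<Rightarrow> 'v" (infixl \<open>\<turnstile>\<^sub>L\<close> 70)
    and dlR :: "'v \<Rightarrow> 'd \<Rightarrow> 'v" (infixl \<open>\<stileturn>\<^sub>R\<close> 70)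
    and drR :: "'v \<Rightarrow> 'd \<Rightarrow> 'v" (infixl \<open>\<turnstile>\<^sub>R\<close> 70)
  assumes dlL_bilinear: "bilinear_map sD sV sV (\<stileturn>\<^sub>L)"
    and drL_bilinear: "bilinear_map sD sV sV (\<turnstile>\<^sub>L)"
    and dlR_bilinear: "bilinear_map sV sD sV (\<stileturn>\<^sub>R)"
    and drR_bilinear: "bilinear_map sV sD sV (\<turnstile>\<^sub>R)"
    and di1_1: "(v \<stileturn>\<^sub>R x) \<stileturn>\<^sub>R y = v \<stileturn>\<^sub>R (x \<stileturn> y)"
    and di1_2: "(x \<stileturn>\<^sub>L v) \<stileturn>\<^sub>R y = x \<stileturn>\<^sub>L (v \<stileturn>\<^sub>R y)"
    and di1_3: "(x \<stileturn> y) \<stileturn>\<^sub>L v = x \<stileturn>\<^sub>L (y \<stileturn>\<^sub>L v)"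
    and di2_1: "(v \<stileturn>\<^sub>R x) \<stileturn>\<^sub>R y = v \<stileturn>\<^sub>R (x \<turnstile> y)"
    and di2_2: "(x \<stileturn>\<^sub>L v) \<stileturn>\<^sub>R y = x \<stileturn>\<^sub>L (v \<turnstile>\<^sub>R y)"
    and di2_3: "(x \<stileturn> y) \<stileturn>\<^sub>L v = x \<stileturn>\<^sub>L (y \<turnstile>\<^sub>L v)"
    and di3_1: "(v \<turnstile>\<^sub>R x) \<stileturn>\<^sub>R y = v \<turnstile>\<^sub>R (x \<stileturn> y)"
    and di3_2: "(x \<turnstile>\<^sub>L v) \<stileturn>\<^sub>R y = x \<turnstile>\<^sub>L (v \<stileturn>\<^sub>R y)"
    and di3_3: "(x \<turnstile> y) \<stileturn>\<^sub>L v = x \<turnstile>\<^sub>L (y \<stileturn>\<^sub>L v)"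
    and di4_1: "(v \<stileturn>\<^sub>R x) \<turnstile>\<^sub>R y = v \<turnstile>\<^sub>R (x \<turnstile> y)"
    and di4_2: "(x \<stileturn>\<^sub>L v) \<turnstile>\<^sub>R y = x \<turnstile>\<^sub>L (v \<turnstile>\<^sub>R y)"
    and di4_3: "(x \<stileturn> y) \<turnstile>\<^sub>L v = x \<turnstile>\<^sub>L (y \<turnstile>\<^sub>L v)"
    and di5_1: "(v \<turnstile>\<^sub>R x) \<turnstile>\<^sub>R y = v \<turnstile>\<^sub>R (x \<turnstile> y)"
    and di5_2: "(x \<turnstile>\<^sub>L v) \<turnstile>\<^sub>R y = x \<turnstile>\<^sub>L (v \<turnstile>\<^sub>R y)"
    and di5_3: "(x \<turnstile> y) \<turnstile>\<^sub>L v = x \<turnstile>\<^sub>L (y \<turnstile>\<^sub>L v)"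

text \<open>The two operations of the induced diassociative algebra \<open>M\<^sub>P\<close>.\<close>

definition induced_dl :: "('m \<Rightarrow> 'a \<Rightarrow> 'm) \<Rightarrow> ('m \<Rightarrow> 'a) \<Rightarrow> 'm \<Rightarrow> 'm \<Rightarrow> 'm" where
  "induced_dl rM P u v = rM u (P v)"

definition induced_dr :: "('a \<Rightarrow> 'm \<Rightarrow> 'm) \<Rightarrow> ('m \<Rightarrow> 'a) \<Rightarrow> 'm \<Rightarrow> 'm \<Rightarrow> 'm" where
  "induced_dr lM P u v = lM (P u) v"

end

theory Submission
  imports Defs
begin

text \<open>
  Each identity of the representation reduces to the compatibility axioms, once the
  averaging identities turn \<open>P (P u \<rhd>\<^sub>M v)\<close> and \<open>P (u \<lhd>\<^sub>M P v)\<close> into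
  \<open>P u \<cdot> P v\<close>. When one action is applied to the correction term of another, the terms
  \<open>Q (l u (Q n))\<close> and \<open>Q (r (Q n) u)\<close> equal \<open>P u \<rhd>\<^sub>B Q n\<close> and
  \<open>Q n \<lhd>\<^sub>B P u\<close>, so that both actions \<open>u \<stileturn> _\<close> and \<open>_ \<turnstile> u\<close>
  vanish on the image of \<open>Q\<close>.
\<close>

lemma linear_diff_fun:
  assumes "Vector_Spaces.linear s t f" "Vector_Spaces.linear s t g"
  shows "Vector_Spaces.linear s t (\<lambda>x. f x - g x)"
proof -
  interpret f: Vector_Spaces.linear s t f by fact
  interpret vector_space_pair s t ..
  show ?thesis using assms by (rule linear_compose_sub)
qed

lemma bilinear_map_diff:
  assumes "bilinear_map sU sV sW f" "bilinear_map sU sV sW g"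
  shows "bilinear_map sU sV sW (\<lambda>u v. f u v - g u v)"
  using assms by (simp add: bilinear_map_def linear_diff_fun)

text \<open>Meant for the correction terms \<open>Q (l u b)\<close> and
  \<open>Q (r b u)\<close>.\<close>

lemma bilinear_map_compose:
  assumes "bilinear_map sU sV sW f" "Vector_Spaces.linear sW sX h"
  shows "bilinear_map sU sV sX (\<lambda>u v. h (f u v))"
  using assms unfolding bilinear_map_def
  by (auto dest: Vector_Spaces.linear_compose[where g = h, unfolded o_def])

lemma bilinear_map_precompose_left:
  assumes "bilinear_map sU sV sW f" "Vector_Spaces.linear sX sU h"
  shows "bilinear_map sX sV sW (\<lambda>x v. f (h x) v)"
  using assms unfolding bilinear_map_def
  by (auto dest: Vector_Spaces.linear_compose[where f = h, unfolded o_def])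

lemma bilinear_map_precompose_right:
  assumes "bilinear_map sU sV sW f" "Vector_Spaces.linear sX sV h"
  shows "bilinear_map sU sX sW (\<lambda>u x. f u (h x))"
  using assms unfolding bilinear_map_def
  by (auto dest: Vector_Spaces.linear_compose[where f = h, unfolded o_def])

lemma bilinear_map_diff_left:
  assumes "bilinear_map sU sV sW f"
  shows "f (u - u') v = f u v - f u' v"
  using assms module_hom.diff[of sU sW "\<lambda>u. f u v"]
  by (simp add: bilinear_map_def linear_iff_module_hom)

lemma bilinear_map_diff_right:
  assumes "bilinear_map sU sV sW f"
  shows "f u (v - v') = f u v - f u v'"
  using assms module_hom.diff[of sV sW "f u"]
  by (simp add: bilinear_map_def linear_iff_module_hom)

context relative_averaging_algebra
begin

text \<open>A representation presupposes its algebra; this discharges that part of the final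
  goal.\<close>

sublocale induced: diassociative_algebra sM "induced_dl rM P" "induced_dr lM P"
proof
  show "bilinear_map sM sM sM (induced_dl rM P)"
    using bilinear_map_precompose_right[OF M.ract_bilinear P_linear]
    by (simp add: induced_dl_def[abs_def])
  show "bilinear_map sM sM sM (induced_dr lM P)"
    using bilinear_map_precompose_left[OF M.lact_bilinear P_linear]
    by (simp add: induced_dr_def[abs_def])
\<comment> \<open>Both products of \<open>u\<close> and \<open>v\<close> have image
  \<open>P u \<cdot> P v\<close> under \<open>P\<close>, so the identities become bimodule
  axioms.\<close>
qed (simp_all add: induced_dl_def induced_dr_def M.lact_mul M.lact_ract M.ract_mul
      flip: P_left P_right)

end

theorem proposition3p26:
  fixes sA :: "'k::field_char_0 \<Rightarrow> 'a::ab_group_add \<Rightarrow> 'a"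
    and mul :: "'a \<Rightarrow> 'a \<Rightarrow> 'a"
    and sM :: "'k \<Rightarrow> 'm::ab_group_add \<Rightarrow> 'm"
    and lM :: "'a \<Rightarrow> 'm \<Rightarrow> 'm" and rM :: "'m \<Rightarrow> 'a \<Rightarrow> 'm"
    and P :: "'m \<Rightarrow> 'a"
    and sN :: "'k \<Rightarrow> 'n::ab_group_add \<Rightarrow> 'n"
    and lN :: "'a \<Rightarrow> 'n \<Rightarrow> 'n" and rN :: "'n \<Rightarrow> 'a \<Rightarrow> 'n"
    and sB :: "'k \<Rightarrow> 'b::ab_group_add \<Rightarrow> 'b"
    and lB :: "'a \<Rightarrow> 'b \<Rightarrow> 'b" and rB :: "'b \<Rightarrow> 'a \<Rightarrow> 'b"
    and Q :: "'n \<Rightarrow> 'b"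
    and l :: "'m \<Rightarrow> 'b \<Rightarrow> 'n" and r :: "'b \<Rightarrow> 'm \<Rightarrow> 'n"
  assumes "relative_averaging_algebra sA mul sM lM rM P"
    and "relative_averaging_bimodule sA mul sM lM rM P sN lN rN sB lB rB Q l r"
  shows "diassociative_representation sM (induced_dl rM P) (induced_dr lM P) sB
           (\<lambda>u b. lB (P u) b - Q (l u b))
           (\<lambda>u b. lB (P u) b)
           (\<lambda>b u. rB b (P u))
           (\<lambda>b u. rB b (P u) - Q (r b u))"
proof -
  interpret relative_averaging_bimodule sA mul sM lM rM P sN lN rN sB lB rB Q l r
    by fact
  \<comment> \<open>Expands any map applied to a corrected action, exposing the nested terms that
    cancel.\<close>
  note diffs = module_hom.diff[OF Q_linear[unfolded linear_iff_module_hom]]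
    bilinear_map_diff_left[OF B.ract_bilinear] bilinear_map_diff_right[OF B.lact_bilinear]
    bilinear_map_diff_left[OF r_bilinear] bilinear_map_diff_right[OF l_bilinear]
  have left: "bilinear_map sM sB sB (\<lambda>u b. lB (P u) b)"
    using B.lact_bilinear P_linear by (rule bilinear_map_precompose_left)
  have right: "bilinear_map sB sM sB (\<lambda>b u. rB b (P u))"
    using B.ract_bilinear P_linear by (rule bilinear_map_precompose_right)
  show ?thesis
  proof
    show "bilinear_map sM sB sB (\<lambda>u b. lB (P u) b - Q (l u b))"
      using left bilinear_map_compose[OF l_bilinear Q_linear] by (rule bilinear_map_diff)
    show "bilinear_map sB sM sB (\<lambda>b u. rB b (P u) - Q (r b u))"
      using right bilinear_map_compose[OF r_bilinear Q_linear] by (rule bilinear_map_diff)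
  \<comment> \<open>The normal form puts \<open>Q\<close> outermost:
    \<open>P u \<rhd>\<^sub>B Q n\<close> and \<open>Q (l u (Q n))\<close> both become
    \<open>Q (P u \<rhd>\<^sub>N n)\<close>, and dually on the right. \<open>PQ_l\<close> and
    \<open>QP_r\<close> are reversed because they share their left-hand sides with
    \<open>PQ_left\<close> and \<open>QP_right\<close>.\<close>
  qed (simp_all add: left right induced_dl_def induced_dr_def diffs
      B.lact_mul B.lact_ract B.ract_mul l_left l_mid l_right r_left r_mid r_right
      PQ_left QP_right flip: P_left P_right PQ_l QP_r)
qed

end
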